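(* Let $m\le n$ and let $S=\{\mathbf{u}_1,\dots,\mathbf{u}_m\}\subseteq\mathbb{F}_2^n$ be a permutative set of $m$ distinct vectors. Then the disjunctive closure \[\langle S\rangle_\vee:=\{a_1\mathbf{u}_1\vee a_2\mathbf{u}_2\vee\cdots\vee a_m\mathbf{u}_m\mid a_i\in\mathbb{F}_2,\ 1\le i\le m\}\] is a powerful set of size $2^m$.
   Context: A set $S\subseteq\mathbb{F}_2^n$ is a powerful set if for every $X\subseteq[n]$ the number of vectors in $S$ that are zero in all positions of $X$ is a power of $2$. For $\mathbf{u}=(u_i),\mathbf{v}=(v_i)\in\mathbb{F}_2^n$, $\mathbf{u}\vee\mathbf{v}:=(\max\{u_i,v_i\})_{i=1}^n$; for $a\in\mathbb{F}_2$, $a\mathbf{u}=\mathbf{u}$ if $a=1$ and $a\mathbf{u}=\mathbf{0}$ if $a=0$. A set $S\subseteq\mathbb{F}_2^n$ is permutative if the $|S|\times n$ matrix whose rows are the elements of $S$ contains a $|S|\times|S|$ submatrix (obtained by choosing $|S|$ columns) that is a permutation matrix, i.e. has exactly one entry $1$ in each row and each column and $0$s elsewhere. *)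

theory Defs
  imports "HOL-Library.Z2" "Jordan_Normal_Form.DL_Submatrix"
begin

text \<open>
  \<^typ>\<open>bit\<close> is the field with two elements, and \<^term>\<open>carrier_vec n :: bit vec set\<close> is the
  space of vectors of length \<open>n\<close> over it, with positions \<open>0, \<dots>, n - 1\<close>. The library does not
  order \<^typ>\<open>bit\<close>; the order \<open>0 < 1\<close> is needed for the entrywise maximum.
\<close>

instantiation bit :: linorder
begin

definition less_eq_bit :: "bit \<Rightarrow> bit \<Rightarrow> bool"
  where "a \<le> b \<longleftrightarrow> a = 0 \<or> b = 1" for a b :: bit

definition less_bit :: "bit \<Rightarrow> bit \<Rightarrow> bool"
  where "a < b \<longleftrightarrow> a = 0 \<and> b = 1" for a b :: bit

instance
proof
  fix a b c :: bit
  show "a < b \<longleftrightarrow> a \<le> b \<and> \<not> b \<le> a"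
    by (cases a; cases b) (simp_all add: less_eq_bit_def less_bit_def)
  show "a \<le> a"
    by (cases a) (simp_all add: less_eq_bit_def)
  show "a \<le> b \<Longrightarrow> b \<le> c \<Longrightarrow> a \<le> c"
    by (cases a; cases b; cases c) (simp_all add: less_eq_bit_def)
  show "a \<le> b \<Longrightarrow> b \<le> a \<Longrightarrow> a = b"
    by (cases a; cases b) (simp_all add: less_eq_bit_def)
  show "a \<le> b \<or> b \<le> a"
    by (cases a; cases b) (simp_all add: less_eq_bit_def)
qed

end

definition powerful :: "nat \<Rightarrow> bit vec set \<Rightarrow> bool" where
  "powerful n S \<longleftrightarrow> S \<subseteq> carrier_vec n \<and>
     (\<forall>X\<subseteq>{..<n}. \<exists>k::nat. card {v \<in> S. \<forall>i\<in>X. v $ i = 0} = 2 ^ k)"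

definition vec_join :: "bit vec \<Rightarrow> bit vec \<Rightarrow> bit vec"  (infixr "\<or>\<^sub>v" 65) where
  "u \<or>\<^sub>v v = vec (dim_vec v) (\<lambda>i. max (u $ i) (v $ i))"

definition permutation_matrix :: "'a::zero_neq_one mat \<Rightarrow> bool" where
  "permutation_matrix P \<longleftrightarrow> square_mat P \<and>
     (\<forall>i<dim_row P. \<forall>j<dim_col P. P $$ (i, j) \<in> {0, 1}) \<and>
     (\<forall>i<dim_row P. \<exists>!j. j < dim_col P \<and> P $$ (i, j) = 1) \<and>
     (\<forall>j<dim_col P. \<exists>!i. i < dim_row P \<and> P $$ (i, j) = 1)"

text \<open>
  The list \<open>rs\<close> enumerates \<open>S\<close> without repetition and thereby fixes an order of the rows; the
  choice of that order does not matter. \<open>J\<close> is the set of chosen columns.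
\<close>

definition permutative :: "nat \<Rightarrow> bit vec set \<Rightarrow> bool" where
  "permutative n S \<longleftrightarrow> S \<subseteq> carrier_vec n \<and>
     (\<exists>rs J. distinct rs \<and> set rs = S \<and> J \<subseteq> {..<n} \<and> card J = card S \<and>
        permutation_matrix (submatrix (mat_of_rows n rs) UNIV J))"

text \<open>
  The empty disjunction is the zero vector. The scalar multiple \<open>a \<cdot>\<^sub>v u\<close> is \<open>u\<close> for \<open>a = 1\<close>
  and the zero vector for \<open>a = 0\<close>.
\<close>

definition disjunctive_closure :: "nat \<Rightarrow> nat \<Rightarrow> (nat \<Rightarrow> bit vec) \<Rightarrow> bit vec set" where
  "disjunctive_closure n m u =
     {foldr (\<or>\<^sub>v) (map (\<lambda>i. a i \<cdot>\<^sub>v u i) [1..<Suc m]) (0\<^sub>v n) | a :: nat \<Rightarrow> bit. True}"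

end

theory Submission
  imports Defs
begin

text \<open>
  Each vector of a permutative set has a private position, at which it alone is nonzero. Hence the
  join of a subfamily determines the subfamily, and joins correspond to subsets of \<open>{1..m}\<close>. A join
  vanishes on \<open>X\<close> iff all vectors in the subfamily do, so the joins vanishing on \<open>X\<close> correspond to
  the subsets of a fixed subset of \<open>{1..m}\<close>.
\<close>

text \<open>The private position is the column of the permutation submatrix that holds the 1 of row
  \<open>v\<close>; no other row has a 1 in that column.\<close>

lemma permutative_private_position:
  assumes "permutative n S" and "v \<in> S"
  obtains c where "c < n" and "v $ c = 1" and "\<And>w. w \<in> S \<Longrightarrow> w $ c = 1 \<Longrightarrow> w = v"
proof -
  from assms(1) obtain rs J where rs: "set rs = S" and J: "J \<subseteq> {..<n}"
    and P: "permutation_matrix (submatrix (mat_of_rows n rs) UNIV J)" (is "permutation_matrix ?P")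
    unfolding permutative_def by blast
  have JJ: "{j. j < n \<and> j \<in> J} = J"
    using J by auto
  have rows: "dim_row ?P = length rs" and cols: "dim_col ?P = card J"
    by (simp_all add: dim_submatrix JJ)
  \<comment> \<open>\<open>pick J j\<close> is the \<open>j\<close>-th smallest element of
    \<open>J\<close>, counted from 0: the vector position that column \<open>j\<close> of
    \<open>?P\<close> comes from.\<close>
  have pick_less: "pick J j < n" if "j < card J" for j
    using pick_in_set_le[OF that] J by auto
  have entry: "?P $$ (i, j) = rs ! i $ pick J j" if "i < length rs" "j < card J" for i j
    using that by (simp add: submatrix_index JJ pick_UNIV pick_less mat_of_rows_index)
  obtain i where i: "i < length rs" "rs ! i = v"
    using assms(2) rs by (metis in_set_conv_nth)
  then obtain j where j: "j < card J" "?P $$ (i, j) = 1"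
    using P rows cols unfolding permutation_matrix_def by metis
  show thesis
  proof
    show "pick J j < n"
      using pick_less j by blast
    show "v $ pick J j = 1"
      using entry i j by metis
    fix w assume "w \<in> S" and w: "w $ pick J j = 1"
    then obtain k where k: "k < length rs" "rs ! k = w"
      using rs by (metis in_set_conv_nth)
    have "?P $$ (k, j) = 1"
      using entry[OF k(1) j(1)] k(2) w by simp
    moreover have "\<exists>!i. i < length rs \<and> ?P $$ (i, j) = 1"
      using P j(1) rows cols unfolding permutation_matrix_def by metis
    ultimately have "k = i"
      using i(1) j(2) k(1) by blast
    then show "w = v"
      using i k by simp
  qed
qed

text \<open>Closed form of the join of a subfamily, indexed by a set so that neither coefficients
  nor the order of folding matter; the empty set gives the zero vector.\<close>

definition join_of :: "nat \<Rightarrow> (nat \<Rightarrow> bit vec) \<Rightarrow> nat set \<Rightarrow> bit vec" where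
  "join_of n u A = vec n (\<lambda>i. of_bool (\<exists>k\<in>A. u k $ i = 1))"

lemma join_of_carrier [simp]: "join_of n u A \<in> carrier_vec n"
  by (simp add: join_of_def)

lemma join_of_index: "i < n \<Longrightarrow> join_of n u A $ i = of_bool (\<exists>k\<in>A. u k $ i = 1)"
  by (simp add: join_of_def)

lemma foldr_vec_join_eq_join_of:
  assumes "\<And>k. k \<in> set ks \<Longrightarrow> u k \<in> carrier_vec n"
  shows "foldr (\<or>\<^sub>v) (map (\<lambda>k. a k \<cdot>\<^sub>v u k) ks) (0\<^sub>v n) = join_of n u {k \<in> set ks. a k = 1}"
  using assms
proof (induction ks)
  case Nil
  show ?case
    by (auto simp: join_of_def)
next
  case (Cons k ks)
  have "(a k \<cdot>\<^sub>v u k) \<or>\<^sub>v join_of n u A = join_of n u (if a k = 1 then insert k A else A)" for A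
  proof (rule eq_vecI)
    fix i assume "i < dim_vec (join_of n u (if a k = 1 then insert k A else A))"
    \<comment> \<open>The entry of \<open>a k \<cdot>\<^sub>v u k\<close> at \<open>i\<close> is
      only known for \<open>i\<close> below the dimension of \<open>u k\<close>, hence the carrier
      hypothesis.\<close>
    then have i: "i < n" "i < dim_vec (u k)"
      using Cons.prems[of k] by (auto simp: join_of_def)
    show "((a k \<cdot>\<^sub>v u k) \<or>\<^sub>v join_of n u A) $ i
        = join_of n u (if a k = 1 then insert k A else A) $ i"
      using i by (cases "a k"; cases "u k $ i")
        (simp_all add: vec_join_def join_of_def max_def less_eq_bit_def)
  qed (simp add: vec_join_def join_of_def)
  moreover have "{l \<in> set (k # ks). a l = 1}
      = (if a k = 1 then insert k {l \<in> set ks. a l = 1} else {l \<in> set ks. a l = 1})"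
    by auto
  ultimately show ?case
    using Cons by simp
qed

lemma disjunctive_closure_eq_image:
  assumes "\<And>k. k \<in> {1..m} \<Longrightarrow> u k \<in> carrier_vec n"
  shows "disjunctive_closure n m u = join_of n u ` Pow {1..m}"
proof -
  have set_eq: "set [1..<Suc m] = {1..m}"
    by auto
  have "foldr (\<or>\<^sub>v) (map (\<lambda>k. a k \<cdot>\<^sub>v u k) [1..<Suc m]) (0\<^sub>v n)
      = join_of n u {k \<in> {1..m}. a k = 1}" for a
    using foldr_vec_join_eq_join_of[of "[1..<Suc m]" u n a] assms unfolding set_eq by blast
  then have "disjunctive_closure n m u = {join_of n u {k \<in> {1..m}. a k = 1} | a :: nat \<Rightarrow> bit. True}"
    by (simp only: disjunctive_closure_def)
  also have "\<dots> = join_of n u ` Pow {1..m}"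
  proof
    show "join_of n u ` Pow {1..m} \<subseteq> {join_of n u {k \<in> {1..m}. a k = 1} | a :: nat \<Rightarrow> bit. True}"
    proof
      fix v assume "v \<in> join_of n u ` Pow {1..m}"
      then obtain A where A: "A \<subseteq> {1..m}" "v = join_of n u A"
        by blast
      \<comment> \<open>The coefficients are the indicator function of \<open>A\<close>; as
        \<open>A\<close> lies in \<open>{1..m}\<close>, cutting down to \<open>{1..m}\<close> loses
        nothing.\<close>
      then have "v = join_of n u {k \<in> {1..m}. of_bool (k \<in> A) = (1 :: bit)}"
        by (auto intro!: arg_cong[of _ _ "join_of n u"])
      then show "v \<in> {join_of n u {k \<in> {1..m}. a k = 1} | a :: nat \<Rightarrow> bit. True}"
        by (intro CollectI exI[of _ "\<lambda>k. of_bool (k \<in> A)"]) simp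
    qed
  qed auto
  finally show ?thesis .
qed

text \<open>For \<open>k\<close> in \<open>K\<close>, membership in \<open>A\<close> can be read off
  the join: its entry at the private position of \<open>k\<close> is 1 exactly if \<open>k\<close>
  is in \<open>A\<close>.\<close>

lemma inj_on_join_of:
  assumes "\<And>k. k \<in> K \<Longrightarrow> \<exists>c<n. u k $ c = 1 \<and> (\<forall>l\<in>K. u l $ c = 1 \<longrightarrow> l = k)"
  shows "inj_on (join_of n u) (Pow K)"
proof -
  \<comment> \<open>One inclusion suffices, since \<open>A\<close> and \<open>B\<close> can be
    exchanged.\<close>
  have "A \<subseteq> B" if AB: "A \<subseteq> K" "B \<subseteq> K" "join_of n u A = join_of n u B" for A B
  proof
    fix k assume k: "k \<in> A"
    then obtain c where c: "c < n" "u k $ c = 1" "\<forall>l\<in>K. u l $ c = 1 \<longrightarrow> l = k"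
      using assms AB(1) by blast
    have "join_of n u A $ c = 1"
      using k c(1,2) by (auto simp: join_of_index)
    then have "join_of n u B $ c = 1"
      using AB(3) by simp
    then obtain l where "l \<in> B" "u l $ c = 1"
      unfolding join_of_index[OF c(1)] of_bool_eq_1_iff by blast
    then show "k \<in> B"
      using c(3) AB(2) by blast
  qed
  then show ?thesis
    by (intro inj_onI subset_antisym) auto
qed

text \<open>A maximum of bits is 0 iff all of them are. In this form the index sets whose join
  vanishes on \<open>X\<close> are visibly a power set.\<close>

lemma join_of_eq_0_on_iff:
  assumes "X \<subseteq> {..<n}"
  shows "(\<forall>i\<in>X. join_of n u A $ i = 0) \<longleftrightarrow> A \<subseteq> {k. \<forall>i\<in>X. u k $ i = 0}"
proof -
  have "join_of n u A $ i = 0 \<longleftrightarrow> (\<forall>k\<in>A. u k $ i = 0)" if "i \<in> X" for i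
    using that assms by (auto simp: join_of_index)
  then show ?thesis
    by auto
qed

theorem theorem8:
  fixes n m :: nat and u :: "nat \<Rightarrow> bit vec" and S :: "bit vec set"
  assumes "m \<le> n"
    and "S = u ` {1..m}" and "inj_on u {1..m}"
    and "S \<subseteq> carrier_vec n"
    and "permutative n S"
  shows "powerful n (disjunctive_closure n m u) \<and>
         card (disjunctive_closure n m u) = 2 ^ m"
proof -
  have closure: "disjunctive_closure n m u = join_of n u ` Pow {1..m}"
    using assms(2,4) by (intro disjunctive_closure_eq_image) auto
  have inj: "inj_on (join_of n u) (Pow {1..m})"
  proof (rule inj_on_join_of)
    fix k assume k: "k \<in> {1..m}"
    then have "u k \<in> S"
      using assms(2) by blast
    then obtain c where c: "c < n" "u k $ c = 1" "\<And>w. w \<in> S \<Longrightarrow> w $ c = 1 \<Longrightarrow> w = u k"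
      using permutative_private_position[OF assms(5)] by blast
    \<comment> \<open>The private position identifies a vector; injectivity of \<open>u\<close>
      turns this into an index.\<close>
    then show "\<exists>c<n. u k $ c = 1 \<and> (\<forall>l\<in>{1..m}. u l $ c = 1 \<longrightarrow> l = k)"
      using k assms(2) inj_onD[OF assms(3)] by blast
  qed
  \<comment> \<open>Used twice: \<open>K = {1..m}\<close> gives the size of the closure, and the
    indices of the vectors vanishing on \<open>X\<close> give the count for
    \<open>X\<close>.\<close>
  have card_image_Pow: "card (join_of n u ` Pow K) = 2 ^ card K" if "K \<subseteq> {1..m}" for K
  proof -
    have "finite K"
      using that finite_subset by blast
    moreover have "inj_on (join_of n u) (Pow K)"
      using inj that by (meson Pow_mono inj_on_subset)
    ultimately show ?thesis
      by (simp add: card_image card_Pow)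
  qed
  have "\<exists>j. card {v \<in> disjunctive_closure n m u. \<forall>i\<in>X. v $ i = 0} = 2 ^ j"
    if "X \<subseteq> {..<n}" for X
  proof -
    let ?K = "{k \<in> {1..m}. \<forall>i\<in>X. u k $ i = 0}"
    have "{v \<in> disjunctive_closure n m u. \<forall>i\<in>X. v $ i = 0}
        = join_of n u ` {A \<in> Pow {1..m}. \<forall>i\<in>X. join_of n u A $ i = 0}"
      unfolding closure by blast
    also have "{A \<in> Pow {1..m}. \<forall>i\<in>X. join_of n u A $ i = 0} = Pow ?K"
      unfolding join_of_eq_0_on_iff[OF that] by blast
    finally have "card {v \<in> disjunctive_closure n m u. \<forall>i\<in>X. v $ i = 0} = 2 ^ card ?K"
      using card_image_Pow[of ?K] by (metis (no_types, lifting) mem_Collect_eq subsetI)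
    then show ?thesis ..
  qed
  then have "powerful n (disjunctive_closure n m u)"
    unfolding powerful_def closure by auto
  then show ?thesis
    using card_image_Pow[of "{1..m}"] closure by simp
qed

end
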